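(* Let $\mathcal{B}=B(F_1,\ldots,F_m)\subseteq 2^{[n]}$ be a Borel set such that $|F_i|=|F_j|$ for all $i,j$, and suppose $\Delta$ is the simplicial complex on $[n]$ with $\mathcal{F}(\Delta)=\mathcal{B}$. Then $L_k(\Delta)^{sq}$ is a squarefree Borel ideal for all $k$.
   Context: Let $K$ be a field, $[n]=\{1,\ldots,n\}$, $S=K[x_1,\ldots,x_n]$, and $x_F=\prod_{i\in F}x_i$ for $F\subseteq[n]$. A subset $\mathcal{B}\subseteq 2^{[n]}$ is Borel if whenever $F\in\mathcal{B}$, $i<j$, $i\in[n]\setminus F$ and $j\in F$, then $(F\setminus\{j\})\cup\{i\}\in\mathcal{B}$. $B(F_1,\ldots,F_m)$ denotes the smallest Borel subset of $2^{[n]}$ containing $F_1,\ldots,F_m$. A squarefree monomial ideal $I\subseteq S$ is a squarefree Borel ideal if there is a Borel set $\mathcal{B}\subseteq 2^{[n]}$ with $I=(x_F : F\in\mathcal{B})$. $\mathcal{F}(\Delta)$ is the set of facets (maximal faces) of $\Delta$. For $k\ge 0$, a $k$-cover of $\Delta$ is a nonzero vector $c\in\mathbb{Z}_{\ge 0}^n$ with $\sum_{i\in F}c_i\ge k$ for every facet $F$; it is squarefree if all $c_i\le 1$. $B(\Delta)\subseteq S[t]$ is the $S$-subalgebra generated by all $x^ct^k$ with $k\ge 1$ and $c$ a squarefree $k$-cover of $\Delta$, where $x^c=x_1^{c_1}\cdots x_n^{c_n}$; write $B(\Delta)=\bigoplus_{k\ge 0}L_k(\Delta)t^k$ with monomial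 ideals $L_k(\Delta)\subseteq S$. For a monomial ideal $I$, $I^{sq}$ is the ideal generated by all squarefree monomials in $I$. *)

theory Defs
  imports
    "HOL-Library.Poly_Mapping"
    "HOL-Algebra.Ideal"
    "HOL-Algebra.Generated_Rings"
    "HOL-Algebra.UnivPoly"
begin

section \<open>The polynomial ring in the variables \<open>x\<^sub>1, \<dots>, x\<^sub>n\<close>\<close>

text \<open>Polynomials in variables indexed by all naturals are finitely supported functions from
  exponent vectors to coefficients; multiplication on this type is convolution.\<close>

type_synonym 'k mpoly = "(nat \<Rightarrow>\<^sub>0 nat) \<Rightarrow>\<^sub>0 'k"

definition poly_ring :: "nat \<Rightarrow> ('k::field mpoly) ring" where
  "poly_ring n =
     \<lparr>carrier = {p. \<forall>m \<in> Poly_Mapping.keys p. Poly_Mapping.keys m \<subseteq> {1..n}},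
      mult = (*), one = 1, zero = 0, add = (+)\<rparr>"

lemma poly_ring_cring: "cring (poly_ring n :: ('k::field mpoly) ring)"
proof (rule cringI)
  show "abelian_group (poly_ring n :: 'k mpoly ring)"
  proof (rule abelian_groupI)
    fix p q :: "'k mpoly"
    assume "p \<in> carrier (poly_ring n)" "q \<in> carrier (poly_ring n)"
    then show "p \<oplus>\<^bsub>poly_ring n\<^esub> q \<in> carrier (poly_ring n)"
      using Poly_Mapping.keys_add[of p q] by (auto simp: poly_ring_def)
  next
    fix p :: "'k mpoly"
    assume "p \<in> carrier (poly_ring n)"
    then show "\<exists>q\<in>carrier (poly_ring n). q \<oplus>\<^bsub>poly_ring n\<^esub> p = \<zero>\<^bsub>poly_ring n\<^esub>"
      by (intro bexI[of _ "- p"]) (auto simp: poly_ring_def)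
  qed (auto simp: poly_ring_def algebra_simps)
next
  show "comm_monoid (poly_ring n :: 'k mpoly ring)"
  proof (rule comm_monoidI)
    fix p q :: "'k mpoly"
    assume pq: "p \<in> carrier (poly_ring n)" "q \<in> carrier (poly_ring n)"
    have "Poly_Mapping.keys m \<subseteq> {1..n}" if m: "m \<in> Poly_Mapping.keys (p * q)" for m
    proof -
      obtain a b where ab: "m = a + b" "a \<in> Poly_Mapping.keys p" "b \<in> Poly_Mapping.keys q"
        using m Poly_Mapping.keys_mult[of p q] by blast
      then show ?thesis
        using pq Poly_Mapping.keys_add[of a b] unfolding poly_ring_def by fastforce
    qed
    then show "p \<otimes>\<^bsub>poly_ring n\<^esub> q \<in> carrier (poly_ring n)"
      by (auto simp: poly_ring_def)
  qed (auto simp: poly_ring_def algebra_simps)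
qed (auto simp: poly_ring_def algebra_simps)

definition var :: "nat \<Rightarrow> 'k::field mpoly" where
  "var i = Poly_Mapping.single (Poly_Mapping.single i 1) 1"

definition xset :: "nat set \<Rightarrow> 'k::field mpoly" where
  "xset F = (\<Prod>i\<in>F. var i)"

definition xpow :: "nat \<Rightarrow> (nat \<Rightarrow> nat) \<Rightarrow> 'k::field mpoly" where
  "xpow n c = (\<Prod>i\<in>{1..n}. var i ^ c i)"

definition sq_part :: "nat \<Rightarrow> 'k::field mpoly set \<Rightarrow> 'k mpoly set" where
  "sq_part n I = Idl\<^bsub>poly_ring n\<^esub> {xset F | F. F \<subseteq> {1..n} \<and> xset F \<in> I}"


section \<open>Borel sets and squarefree Borel ideals\<close>

definition borel_set :: "nat \<Rightarrow> nat set set \<Rightarrow> bool" where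
  "borel_set n \<B> \<longleftrightarrow> \<B> \<subseteq> Pow {1..n} \<and>
     (\<forall>F\<in>\<B>. \<forall>i j. i < j \<and> i \<in> {1..n} - F \<and> j \<in> F \<longrightarrow> (F - {j}) \<union> {i} \<in> \<B>)"

text \<open>As \<open>Pow {1..n}\<close> is itself Borel, this is the smallest Borel set containing
  \<open>\<G>\<close> whenever \<open>\<G> \<subseteq> Pow {1..n}\<close>.\<close>

definition borel_hull :: "nat \<Rightarrow> nat set set \<Rightarrow> nat set set" where
  "borel_hull n \<G> = \<Inter>{\<B>. borel_set n \<B> \<and> \<G> \<subseteq> \<B>}"

definition squarefree_borel_ideal :: "nat \<Rightarrow> 'k::field mpoly set \<Rightarrow> bool" where
  "squarefree_borel_ideal n I \<longleftrightarrow>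
     (\<exists>\<B>. borel_set n \<B> \<and> I = Idl\<^bsub>poly_ring n\<^esub> (xset ` \<B>))"


section \<open>Simplicial complexes and their covers\<close>

text \<open>Elements of \<open>{1..n}\<close> are not required to be vertices of the complex.\<close>

definition simplicial_complex :: "nat \<Rightarrow> nat set set \<Rightarrow> bool" where
  "simplicial_complex n \<Delta> \<longleftrightarrow>
     \<Delta> \<subseteq> Pow {1..n} \<and> (\<forall>F\<in>\<Delta>. \<forall>G. G \<subseteq> F \<longrightarrow> G \<in> \<Delta>)"

definition facets :: "nat set set \<Rightarrow> nat set set" where
  "facets \<Delta> = {F \<in> \<Delta>. \<forall>G\<in>\<Delta>. F \<subseteq> G \<longrightarrow> F = G}"

text \<open>A vector indexed by \<open>{1..n}\<close> is a function on the naturals of which only the values on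
  \<open>{1..n}\<close> matter.\<close>

definition k_cover :: "nat \<Rightarrow> nat set set \<Rightarrow> nat \<Rightarrow> (nat \<Rightarrow> nat) \<Rightarrow> bool" where
  "k_cover n \<Delta> k c \<longleftrightarrow>
     (\<exists>i\<in>{1..n}. c i \<noteq> 0) \<and> (\<forall>F\<in>facets \<Delta>. (\<Sum>i\<in>F. c i) \<ge> k)"

definition squarefree_vec :: "nat \<Rightarrow> (nat \<Rightarrow> nat) \<Rightarrow> bool" where
  "squarefree_vec n c \<longleftrightarrow> (\<forall>i\<in>{1..n}. c i \<le> 1)"

text \<open>With \<open>S = poly_ring n\<close>, the ring \<open>S[t]\<close> is \<open>UP S\<close> and \<open>f t\<^sup>k\<close> is
  \<open>up_ring.monom (UP S) f k\<close>. The \<open>S\<close>-subalgebra generated by a set is the subring generated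
  by that set together with the constants \<open>f t\<^sup>0\<close>.\<close>

definition cover_algebra :: "nat \<Rightarrow> nat set set \<Rightarrow> (nat \<Rightarrow> 'k::field mpoly) set" where
  "cover_algebra n \<Delta> = generate_ring (UP (poly_ring n))
     ({up_ring.monom (UP (poly_ring n)) f 0 | f. f \<in> carrier (poly_ring n)} \<union>
      {up_ring.monom (UP (poly_ring n)) (xpow n c) k | c k.
         k \<ge> 1 \<and> k_cover n \<Delta> k c \<and> squarefree_vec n c})"

definition cover_ideal :: "nat \<Rightarrow> nat set set \<Rightarrow> nat \<Rightarrow> 'k::field mpoly set" where
  "cover_ideal n \<Delta> k =
     {f \<in> carrier (poly_ring n). up_ring.monom (UP (poly_ring n)) f k \<in> cover_algebra n \<Delta>}"

end

theory Submission
  imports Defs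
begin

text \<open>
  The squarefree monomials in \<open>L\<^sub>k(\<Delta>)\<close> can be described without reference to the generators
  of the cover algebra. A sum of a \<open>j\<close>-cover and an \<open>l\<close>-cover is a \<open>(j + l)\<close>-cover, so by
  induction over the generated subring every monomial of the coefficient of \<open>t\<^sup>k\<close>, for
  \<open>k \<ge> 1\<close>, has a \<open>k\<close>-cover as exponent vector (\<open>cover_algebra_coeff_keys\<close>). If this
  monomial is squarefree, its exponent vector is a squarefree \<open>k\<close>-cover, hence already one of the
  generators. Therefore \<open>x\<^sub>G \<in> L\<^sub>k(\<Delta>)\<close> if and only if \<open>k = 0\<close> or the indicator vector of \<open>G\<close>
  is a \<open>k\<close>-cover, that is, \<open>G\<close> is nonempty and meets every facet in at least \<open>k\<close> elements
  (\<open>xset_in_cover_ideal_iff\<close>).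

  The Borel property passes from the facets to these sets \<open>G\<close> (\<open>borel_set_k_covers\<close>): if
  exchanging \<open>j \<in> G\<close> for a smaller \<open>i \<notin> G\<close> spoils the condition at a facet \<open>F\<close>, then \<open>F\<close>
  contains \<open>j\<close> but not \<open>i\<close>, so \<open>F - {j} \<union> {i}\<close> is again a facet, and already \<open>G\<close> meets it in
  fewer than \<open>k\<close> elements.
\<close>

section \<open>Squarefree monomials\<close>

lemma var_power: "var i ^ e = Poly_Mapping.single (Poly_Mapping.single i e) 1"
  by (induction e) (simp_all add: var_def mult_single flip: single_add)

definition exponent_vec :: "nat \<Rightarrow> (nat \<Rightarrow> nat) \<Rightarrow> (nat \<Rightarrow>\<^sub>0 nat)" where
  "exponent_vec n c = (\<Sum>i\<in>{1..n}. Poly_Mapping.single i (c i))"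

lemma lookup_exponent_vec:
  "Poly_Mapping.lookup (exponent_vec n c) j = (if j \<in> {1..n} then c j else 0)"
proof -
  have "Poly_Mapping.lookup (exponent_vec n c) j = (\<Sum>i\<in>{1..n}. if i = j then c i else 0)"
    by (simp add: exponent_vec_def lookup_sum lookup_single when_def)
  then show ?thesis
    by (simp only: sum.delta finite_atLeastAtMost)
qed

lemma keys_exponent_vec: "Poly_Mapping.keys (exponent_vec n c) \<subseteq> {1..n}"
  by (auto simp only: in_keys_iff lookup_exponent_vec split: if_splits)

lemma xpow_eq_single: "xpow n c = Poly_Mapping.single (exponent_vec n c) 1"
proof -
  have "(\<Prod>i\<in>A. var i ^ c i) = Poly_Mapping.single (\<Sum>i\<in>A. Poly_Mapping.single i (c i)) 1"
    if "finite A" for A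
    using that by (induction A) (simp_all add: var_power mult_single)
  then show ?thesis
    unfolding xpow_def exponent_vec_def by blast
qed

lemma xpow_in_poly_ring: "xpow n c \<in> carrier (poly_ring n)"
  using keys_exponent_vec by (simp add: poly_ring_def xpow_eq_single)

lemma xpow_indicator:
  assumes "G \<subseteq> {1..n}"
  shows "xpow n (\<lambda>i. of_bool (i \<in> G)) = xset G"
proof -
  have "xpow n (\<lambda>i. of_bool (i \<in> G)) = (\<Prod>i\<in>{1..n}. if i \<in> G then var i else 1)"
    unfolding xpow_def by (intro prod.cong) auto
  also have "\<dots> = prod var ({1..n} \<inter> G)"
    by (simp add: prod.inter_restrict)
  finally show ?thesis
    using assms by (simp add: xset_def Int_absorb1)
qed

section \<open>Exponents in the cover algebra\<close>

text \<open>The exponent vectors that can occur next to \<open>t\<^sup>k\<close>. For \<open>k = 0\<close> every vector is allowed,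
  the zero vector included, because the cover algebra contains all of \<open>S\<close>.\<close>

definition cover_exponents :: "nat \<Rightarrow> nat set set \<Rightarrow> nat \<Rightarrow> (nat \<Rightarrow>\<^sub>0 nat) set" where
  "cover_exponents n \<Delta> k =
     {e. Poly_Mapping.keys e \<subseteq> {1..n} \<and> (k = 0 \<or> k_cover n \<Delta> k (Poly_Mapping.lookup e))}"

lemma k_cover_mono:
  assumes "k_cover n \<Delta> k c" and "\<And>i. c i \<le> d i"
  shows "k_cover n \<Delta> k d"
proof -
  have "k \<le> sum d F" if "F \<in> facets \<Delta>" for F
    using that assms order_trans[of k "sum c F" "sum d F"] sum_mono[of F c d]
    unfolding k_cover_def by blast
  moreover obtain i where "i \<in> {1..n}" "c i \<noteq> 0"
    using assms(1) unfolding k_cover_def by blast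
  then have "i \<in> {1..n}" "d i \<noteq> 0"
    using assms(2)[of i] by simp_all
  ultimately show ?thesis
    unfolding k_cover_def by blast
qed

lemma k_cover_add:
  assumes "k_cover n \<Delta> j c" and "k_cover n \<Delta> l d"
  shows "k_cover n \<Delta> (j + l) (\<lambda>i. c i + d i)"
  using assms by (auto simp: k_cover_def sum.distrib intro: add_mono)

text \<open>A vector next to \<open>t\<^sup>0\<close> need not be a cover, as it may vanish; adding it to a cover of
  positive order still gives a cover of that order.\<close>

lemma cover_exponents_add:
  assumes "a \<in> cover_exponents n \<Delta> j" and "b \<in> cover_exponents n \<Delta> l"
  shows "a + b \<in> cover_exponents n \<Delta> (j + l)"
proof -
  have "Poly_Mapping.keys (a + b) \<subseteq> {1..n}"
    using assms Poly_Mapping.keys_add[of a b] by (auto simp: cover_exponents_def)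
  moreover have "k_cover n \<Delta> (j + l) (Poly_Mapping.lookup (a + b))" if "j + l \<noteq> 0"
  proof -
    consider "j = 0" "k_cover n \<Delta> l (Poly_Mapping.lookup b)"
      | "l = 0" "k_cover n \<Delta> j (Poly_Mapping.lookup a)"
      | "k_cover n \<Delta> j (Poly_Mapping.lookup a)" "k_cover n \<Delta> l (Poly_Mapping.lookup b)"
      using assms \<open>j + l \<noteq> 0\<close> by (auto simp: cover_exponents_def)
    then show ?thesis
    proof cases
      case 1
      then show ?thesis by (auto intro: k_cover_mono simp: lookup_add)
    next
      case 2
      then show ?thesis by (auto intro: k_cover_mono simp: lookup_add)
    next
      case 3
      then show ?thesis by (subst lookup_add[abs_def]) (rule k_cover_add)
    qed
  qed
  ultimately show ?thesis
    unfolding cover_exponents_def mem_Collect_eq by metis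
qed

lemma exponent_vec_in_cover_exponents_iff:
  assumes "simplicial_complex n \<Delta>"
  shows "exponent_vec n c \<in> cover_exponents n \<Delta> k \<longleftrightarrow> k = 0 \<or> k_cover n \<Delta> k c"
proof -
  have "sum (Poly_Mapping.lookup (exponent_vec n c)) F = sum c F" if "F \<in> facets \<Delta>" for F
  proof (rule sum.cong)
    fix i
    assume "i \<in> F"
    then have "i \<in> {1..n}"
      using that assms unfolding facets_def simplicial_complex_def by blast
    then show "Poly_Mapping.lookup (exponent_vec n c) i = c i"
      by (simp only: lookup_exponent_vec if_True)
  qed simp
  then have "k_cover n \<Delta> k (Poly_Mapping.lookup (exponent_vec n c)) \<longleftrightarrow> k_cover n \<Delta> k c"
    unfolding k_cover_def by (simp add: lookup_exponent_vec)
  then show ?thesis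
    using keys_exponent_vec by (simp add: cover_exponents_def)
qed

lemma a_inv_poly_ring:
  assumes "f \<in> carrier (poly_ring n)"
  shows "\<ominus>\<^bsub>poly_ring n\<^esub> f = - f"
proof -
  interpret R: cring "poly_ring n" by (rule poly_ring_cring)
  show ?thesis
    using assms by (intro R.minus_equality) (auto simp: poly_ring_def)
qed

lemma keys_finsum_poly_ring:
  assumes "finite A"
    and "\<And>i. i \<in> A \<Longrightarrow> f i \<in> carrier (poly_ring n) \<and> Poly_Mapping.keys (f i) \<subseteq> E"
  shows "Poly_Mapping.keys (finsum (poly_ring n) f A) \<subseteq> E"
proof -
  interpret R: cring "poly_ring n" by (rule poly_ring_cring)
  from assms show ?thesis
  proof (induction A)
    case empty
    then show ?case by simp (simp add: poly_ring_def)
  next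
    case (insert x A)
    then have "finsum (poly_ring n) f (insert x A) = f x + finsum (poly_ring n) f A"
      by (subst R.finsum_insert) (auto simp: poly_ring_def)
    with insert show ?case
      using Poly_Mapping.keys_add[of "f x" "finsum (poly_ring n) f A"] by auto
  qed
qed

text \<open>The conclusion describes a subring of \<open>S[t]\<close>, because every exponent vector of the
  coefficient of \<open>t\<^sup>k\<close> in a product has the form \<open>a + b\<close>, where \<open>a\<close> is taken from the coefficient
  of some \<open>t\<^sup>i\<close> in one factor and \<open>b\<close> from the complementary coefficient in the other, so that
  \<open>cover_exponents_add\<close> applies. The generators of the cover algebra lie in this subring.\<close>

lemma cover_algebra_coeff_keys:
  fixes p :: "nat \<Rightarrow> 'k::field mpoly"
  assumes "simplicial_complex n \<Delta>" and "p \<in> cover_algebra n \<Delta>"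
  shows "p \<in> carrier (UP (poly_ring n)) \<and>
    (\<forall>k. Poly_Mapping.keys (up_ring.coeff (UP (poly_ring n)) p k) \<subseteq> cover_exponents n \<Delta> k)"
proof -
  let ?R = "poly_ring n :: 'k mpoly ring"
  let ?coeff = "up_ring.coeff (UP ?R)"
  interpret UP_cring ?R "UP ?R"
    by (intro UP_cring.intro poly_ring_cring)
  have S_exponents: "Poly_Mapping.keys f \<subseteq> cover_exponents n \<Delta> 0" if "f \<in> carrier ?R" for f
    using that by (auto simp: poly_ring_def cover_exponents_def)
  have zero: "\<zero>\<^bsub>?R\<^esub> = 0"
    by (simp add: poly_ring_def)
  show ?thesis
    using assms(2) unfolding cover_algebra_def
  proof (induction rule: generate_ring.induct)
    case one
    then show ?case
      using S_exponents[OF R.one_closed] by (simp add: zero)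
  next
    case (incl h)
    then consider f where "h = up_ring.monom (UP ?R) f 0" "f \<in> carrier ?R"
      | c k where "h = up_ring.monom (UP ?R) (xpow n c) k" "k_cover n \<Delta> k c"
      by blast
    then show ?case
    proof cases
      case (1 f)
      then show ?thesis
        using S_exponents by (simp add: zero)
    next
      case (2 c k)
      then have "exponent_vec n c \<in> cover_exponents n \<Delta> k"
        using exponent_vec_in_cover_exponents_iff[OF assms(1)] by blast
      then show ?thesis
        using xpow_in_poly_ring[of n c, where ?'a = 'k]
        by (simp add: 2(1) zero) (simp add: xpow_eq_single)
    qed
  next
    case (a_inv h)
    then have "Poly_Mapping.keys (?coeff (\<ominus>\<^bsub>UP ?R\<^esub> h) k) = Poly_Mapping.keys (?coeff h k)" for k
      by (simp add: a_inv_poly_ring)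
    with a_inv show ?case
      by simp
  next
    case (eng_add p q)
    have "Poly_Mapping.keys (?coeff (p \<oplus>\<^bsub>UP ?R\<^esub> q) k) \<subseteq> cover_exponents n \<Delta> k" for k
    proof -
      have "?coeff (p \<oplus>\<^bsub>UP ?R\<^esub> q) k = ?coeff p k + ?coeff q k"
        using eng_add by simp (simp add: poly_ring_def)
      moreover have "Poly_Mapping.keys (?coeff p k + ?coeff q k) \<subseteq> cover_exponents n \<Delta> k"
        using eng_add.IH Poly_Mapping.keys_add[of "?coeff p k" "?coeff q k"] by blast
      ultimately show ?thesis
        by (simp only:)
    qed
    with eng_add show ?case
      by simp
  next
    case (eng_mult p q)
    have "Poly_Mapping.keys (?coeff (p \<otimes>\<^bsub>UP ?R\<^esub> q) k) \<subseteq> cover_exponents n \<Delta> k" for k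
    proof -
      have "Poly_Mapping.keys (?coeff p i \<otimes>\<^bsub>?R\<^esub> ?coeff q (k - i)) \<subseteq> cover_exponents n \<Delta> k"
        if "i \<in> {..k}" for i
      proof
        fix e
        assume "e \<in> Poly_Mapping.keys (?coeff p i \<otimes>\<^bsub>?R\<^esub> ?coeff q (k - i))"
        then have "e \<in> Poly_Mapping.keys (?coeff p i * ?coeff q (k - i))"
          by (simp add: poly_ring_def)
        then obtain a b where "e = a + b" "a \<in> Poly_Mapping.keys (?coeff p i)"
          "b \<in> Poly_Mapping.keys (?coeff q (k - i))"
          using Poly_Mapping.keys_mult by blast
        then have "e \<in> cover_exponents n \<Delta> (i + (k - i))"
          using eng_mult cover_exponents_add by blast
        with that show "e \<in> cover_exponents n \<Delta> k"
          by simp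
      qed
      then have "Poly_Mapping.keys (\<Oplus>\<^bsub>?R\<^esub>i\<in>{..k}. ?coeff p i \<otimes>\<^bsub>?R\<^esub> ?coeff q (k - i))
          \<subseteq> cover_exponents n \<Delta> k"
        using eng_mult by (intro keys_finsum_poly_ring) simp_all
      then show ?thesis
        using eng_mult by simp
    qed
    with eng_mult show ?case
      by simp
  qed
qed

section \<open>Squarefree monomials in the cover ideals\<close>

lemma k_cover_indicator_iff:
  assumes "simplicial_complex n \<Delta>" and "G \<subseteq> {1..n}"
  shows "k_cover n \<Delta> k (\<lambda>i. of_bool (i \<in> G)) \<longleftrightarrow>
    G \<noteq> {} \<and> (\<forall>F\<in>facets \<Delta>. k \<le> card (F \<inter> G))"
proof -
  have "finite F" if "F \<in> facets \<Delta>" for F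
    using that assms(1) finite_subset[of F "{1..n}"]
    by (auto simp: facets_def simplicial_complex_def)
  then have "(\<Sum>i\<in>F. of_bool (i \<in> G)) = card (F \<inter> G)" if "F \<in> facets \<Delta>" for F
    using that by simp
  with assms(2) show ?thesis
    by (auto simp: k_cover_def)
qed

lemma xset_in_poly_ring: "G \<subseteq> {1..n} \<Longrightarrow> xset G \<in> carrier (poly_ring n)"
  using xpow_in_poly_ring xpow_indicator by metis

text \<open>The exponent vector of \<open>xset G\<close> is the indicator vector of \<open>G\<close>. If \<open>xset G t\<^sup>k\<close>
  lies in the cover algebra and \<open>k \<ge> 1\<close>, this vector is a \<open>k\<close>-cover; conversely, a \<open>k\<close>-cover with
  entries in \<open>{0, 1}\<close> is squarefree, so that the monomial is itself a generator.\<close>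

lemma xset_in_cover_ideal_iff:
  assumes "simplicial_complex n \<Delta>" and "G \<subseteq> {1..n}"
  shows "(xset G :: 'k::field mpoly) \<in> cover_ideal n \<Delta> k \<longleftrightarrow>
    k = 0 \<or> G \<noteq> {} \<and> (\<forall>F\<in>facets \<Delta>. k \<le> card (F \<inter> G))"
proof
  let ?R = "poly_ring n :: 'k mpoly ring"
  interpret UP_cring ?R "UP ?R"
    by (intro UP_cring.intro poly_ring_cring)
  assume "(xset G :: 'k mpoly) \<in> cover_ideal n \<Delta> k"
  then have "up_ring.monom (UP ?R) (xset G) k \<in> cover_algebra n \<Delta>"
    by (simp add: cover_ideal_def)
  then have "up_ring.monom (UP ?R) (xpow n (\<lambda>i. of_bool (i \<in> G))) k \<in> cover_algebra n \<Delta>"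
    by (simp only: xpow_indicator[OF assms(2)])
  then have "Poly_Mapping.keys (xpow n (\<lambda>i. of_bool (i \<in> G)) :: 'k mpoly)
      \<subseteq> cover_exponents n \<Delta> k"
    using cover_algebra_coeff_keys[OF assms(1)] xpow_in_poly_ring coeff_monom by metis
  then have "k = 0 \<or> k_cover n \<Delta> k (\<lambda>i. of_bool (i \<in> G))"
    by (simp add: xpow_eq_single exponent_vec_in_cover_exponents_iff[OF assms(1)])
  then show "k = 0 \<or> G \<noteq> {} \<and> (\<forall>F\<in>facets \<Delta>. k \<le> card (F \<inter> G))"
    using k_cover_indicator_iff[OF assms] by blast
next
  assume "k = 0 \<or> G \<noteq> {} \<and> (\<forall>F\<in>facets \<Delta>. k \<le> card (F \<inter> G))"
  then consider "k = 0" | "k \<ge> 1" "k_cover n \<Delta> k (\<lambda>i. of_bool (i \<in> G))"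
    using k_cover_indicator_iff[OF assms] by (cases k) auto
  then have "up_ring.monom (UP (poly_ring n)) (xset G :: 'k mpoly) k \<in> cover_algebra n \<Delta>"
  proof cases
    case 1
    then show ?thesis
      unfolding cover_algebra_def using xset_in_poly_ring[OF assms(2)]
      by (intro generate_ring.incl) blast
  next
    case 2
    moreover have "squarefree_vec n (\<lambda>i. of_bool (i \<in> G))"
      by (simp add: squarefree_vec_def)
    ultimately show ?thesis
      unfolding cover_algebra_def xpow_indicator[OF assms(2), symmetric]
      by (intro generate_ring.incl) blast
  qed
  then show "(xset G :: 'k mpoly) \<in> cover_ideal n \<Delta> k"
    using xset_in_poly_ring[OF assms(2)] by (simp add: cover_ideal_def)
qed

section \<open>The Borel property\<close>

lemma borel_set_borel_hull:
  assumes "\<G> \<subseteq> Pow {1..n}"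
  shows "borel_set n (borel_hull n \<G>)"
proof -
  have "borel_set n (Pow {1..n})"
    by (auto simp: borel_set_def)
  with assms have "borel_hull n \<G> \<subseteq> Pow {1..n}"
    by (auto simp: borel_hull_def)
  then show ?thesis
    unfolding borel_set_def by (auto simp: borel_hull_def borel_set_def)
qed

text \<open>If \<open>F\<close> contains \<open>i\<close> or misses \<open>j\<close>, exchanging \<open>j\<close> for \<open>i\<close> in \<open>G\<close> does not decrease
  \<open>card (F \<inter> G)\<close>. Otherwise the exchange has the same effect on \<open>card (F \<inter> G)\<close> whether it is made
  in \<open>G\<close> or in \<open>F\<close>, and \<open>\<B>\<close> is closed under the latter.\<close>

lemma borel_exchange_card:
  assumes "borel_set n \<B>" and cover: "\<forall>F\<in>\<B>. k \<le> card (F \<inter> G)"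
    and "i < j" "i \<in> {1..n} - G" "j \<in> G" "F \<in> \<B>"
  shows "k \<le> card (F \<inter> ((G - {j}) \<union> {i}))"
proof -
  have "finite F"
    using assms(1) \<open>F \<in> \<B>\<close> finite_subset[of F "{1..n}"] by (auto simp: borel_set_def)
  consider "i \<in> F" | "j \<notin> F" | "i \<notin> F" "j \<in> F"
    by blast
  then show ?thesis
  proof cases
    case 1
    then have "F \<inter> ((G - {j}) \<union> {i}) = insert i (F \<inter> G - {j})"
      by blast
    then have "card (F \<inter> ((G - {j}) \<union> {i})) = Suc (card (F \<inter> G - {j}))"
      using \<open>finite F\<close> assms(4) by simp
    moreover have "card (F \<inter> G) \<le> Suc (card (F \<inter> G - {j}))"
      using \<open>finite F\<close> by (auto simp: card_Diff_singleton_if)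
    ultimately show ?thesis
      using cover \<open>F \<in> \<B>\<close> by fastforce
  next
    case 2
    then have "F \<inter> G \<subseteq> F \<inter> ((G - {j}) \<union> {i})"
      by blast
    then have "card (F \<inter> G) \<le> card (F \<inter> ((G - {j}) \<union> {i}))"
      using \<open>finite F\<close> by (intro card_mono) auto
    then show ?thesis
      using cover \<open>F \<in> \<B>\<close> by fastforce
  next
    case 3
    then have "(F - {j}) \<union> {i} \<in> \<B>"
      using assms by (auto simp: borel_set_def)
    then have "k \<le> card (((F - {j}) \<union> {i}) \<inter> G)"
      using cover by blast
    also have "((F - {j}) \<union> {i}) \<inter> G = F \<inter> ((G - {j}) \<union> {i})"
      using 3 assms(4) by blast
    finally show ?thesis .
  qed
qed

lemma borel_set_k_covers:
  assumes "borel_set n \<B>"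
  shows "borel_set n {G. G \<subseteq> {1..n} \<and> (k = 0 \<or> G \<noteq> {} \<and> (\<forall>F\<in>\<B>. k \<le> card (F \<inter> G)))}"
    (is "borel_set n ?\<G>")
  unfolding borel_set_def
proof (intro conjI ballI allI impI)
  fix G i j
  assume G: "G \<in> ?\<G>" and ij: "i < j \<and> i \<in> {1..n} - G \<and> j \<in> G"
  have "\<forall>F\<in>\<B>. k \<le> card (F \<inter> ((G - {j}) \<union> {i}))" if "\<forall>F\<in>\<B>. k \<le> card (F \<inter> G)"
    using borel_exchange_card[OF assms that] ij by blast
  then show "(G - {j}) \<union> {i} \<in> ?\<G>"
    using G ij by blast
qed blast

theorem proposition3p4:
  fixes n m k :: nat
    and F :: "nat \<Rightarrow> nat set"
    and \<B> \<Delta> :: "nat set set"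
  assumes "\<And>i. i \<in> {1..m} \<Longrightarrow> F i \<subseteq> {1..n}"
    and "\<And>i j. i \<in> {1..m} \<Longrightarrow> j \<in> {1..m} \<Longrightarrow> card (F i) = card (F j)"
    and "\<B> = borel_hull n (F ` {1..m})"
    and "simplicial_complex n \<Delta>"
    and "facets \<Delta> = \<B>"
  shows "squarefree_borel_ideal n (sq_part n (cover_ideal n \<Delta> k :: 'k::field mpoly set))"
proof -
  let ?\<G> = "{G. G \<subseteq> {1..n} \<and> (k = 0 \<or> G \<noteq> {} \<and> (\<forall>F\<in>\<B>. k \<le> card (F \<inter> G)))}"
  have "borel_set n \<B>"
    unfolding assms(3) using assms(1) by (intro borel_set_borel_hull) blast
  then have "borel_set n ?\<G>"
    by (rule borel_set_k_covers)
  moreover have "{xset G :: 'k mpoly | G.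
        G \<subseteq> {1..n} \<and> (xset G :: 'k mpoly) \<in> cover_ideal n \<Delta> k} =
      xset ` ?\<G>"
    using xset_in_cover_ideal_iff[OF assms(4)] unfolding assms(5) by blast
  ultimately show ?thesis
    unfolding squarefree_borel_ideal_def sq_part_def by (intro exI[of _ ?\<G>]) simp
qed

end
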